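(* For any function $f\colon\{0,1\}^n\to\{0,1\}$ and any integer $k\ge 1$: 1. $\mathsf{D}(f^k)\ge k\cdot \mathsf{D}(f)^{1/2}$. 2. $\mathsf{D}(f^k)\ge k\cdot \mathsf{D}(f)/\log \mathrm{spar}(f)$.
   Context: Inner products are over $\mathbb{F}_2$: $\langle a,x\rangle=\sum_i a_ix_i \bmod 2$. A deterministic parity decision tree $T$ on $\{0,1\}^N$ is a rooted binary tree in which every internal node is labelled by a vector $a\in\{0,1\}^N$ (the query $\langle a,x\rangle$) and has two children, one for each outcome in $\{0,1\}$, and every leaf is labelled by an output value; $T(x)$ is the label of the leaf reached on input $x$. The depth of $T$ is the maximum number of queries on a root-to-leaf path. For $g\colon\{0,1\}^N\to\{0,1\}^m$, $\mathsf{D}(g)$ is the least depth of a deterministic parity decision tree $T$ with $T(x)=g(x)$ for all $x$. $f^k\colon(\{0,1\}^n)^k\to\{0,1\}^k$ is the function $f^k(x^1,\dots,x^k)=(f(x^1),\dots,f(x^k))$. The Fourier transform of $f$ (viewed as real-valued) is $\hat f(z)=2^{-n}\sum_{x\in\{0,1\}^n}f(x)(-1)^{\langle x,z\rangle}$, and $\mathrm{spar}(f)=|\{z\in\{0,1\}^n: \hat f(z)\ne 0\}|$ is the number of non-zero Fourier coefficients of $f$. The logarithm $\log$ is to base 2. *)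

theory Defs
  imports Complex_Main "HOL-Library.Z2"
begin

text \<open>
  For a finite index set \<open>I\<close>, the cube \<open>{0,1}^I\<close> consists of the functions into the field
  \<open>bit\<close> that vanish outside \<open>I\<close>. Thus \<open>{0,1}^n\<close> is \<open>cube {..<n}\<close>, and \<open>({0,1}^n)^k\<close> is
  \<open>cube ({..<k} \<times> {..<n})\<close>, the coordinate \<open>(i, j)\<close> being the \<open>j\<close>-th bit of the \<open>i\<close>-th block.
\<close>

definition cube :: "'i set \<Rightarrow> ('i \<Rightarrow> bit) set" where
  "cube I = {x. \<forall>i. i \<notin> I \<longrightarrow> x i = 0}"

definition ip :: "'i set \<Rightarrow> ('i \<Rightarrow> bit) \<Rightarrow> ('i \<Rightarrow> bit) \<Rightarrow> bit" where
  "ip I a x = (\<Sum>i\<in>I. a i * x i)"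

text \<open>In \<open>Query a T0 T1\<close> the subtree \<open>T0\<close> is taken on outcome 0 and \<open>T1\<close> on outcome 1.\<close>

datatype (queries: 'v, outputs: 'o) pdt =
  Leaf 'o
| Query 'v "('v, 'o) pdt" "('v, 'o) pdt"

primrec depth :: "('v, 'o) pdt \<Rightarrow> nat" where
  "depth (Leaf c) = 0"
| "depth (Query a T0 T1) = Suc (max (depth T0) (depth T1))"

primrec run :: "'i set \<Rightarrow> ('i \<Rightarrow> bit, 'o) pdt \<Rightarrow> ('i \<Rightarrow> bit) \<Rightarrow> 'o" where
  "run I (Leaf c) x = c"
| "run I (Query a T0 T1) x = (if ip I a x = 0 then run I T0 x else run I T1 x)"

definition computes :: "'i set \<Rightarrow> ('i \<Rightarrow> bit, 'o) pdt \<Rightarrow> (('i \<Rightarrow> bit) \<Rightarrow> 'o) \<Rightarrow> bool" where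
  "computes I T g \<longleftrightarrow> queries T \<subseteq> cube I \<and> (\<forall>x\<in>cube I. run I T x = g x)"

definition pdt_complexity :: "'i set \<Rightarrow> (('i \<Rightarrow> bit) \<Rightarrow> 'o) \<Rightarrow> nat" where
  "pdt_complexity I g = (LEAST d. \<exists>T. computes I T g \<and> depth T = d)"

text \<open>For finite \<open>I\<close> the least depth is attained, as some tree computes \<open>g\<close>.\<close>

lemma computes_exists:
  fixes g :: "('i \<Rightarrow> bit) \<Rightarrow> 'o"
  assumes "finite I"
  shows "\<exists>T. computes I T g"
proof -
  have "\<exists>T. queries T \<subseteq> cube I \<and>
          (\<forall>x\<in>cube I. (\<forall>i\<in>I - J. x i = y i) \<longrightarrow> run I T x = g x)"
    if "finite J" "J \<subseteq> I" for J and y :: "'i \<Rightarrow> bit"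
    using that
  proof (induction J arbitrary: y rule: finite_induct)
    case empty
    define c where "c = (\<lambda>i. if i \<in> I then y i else 0)"
    have "x = c" if "x \<in> cube I" "\<forall>i\<in>I. x i = y i" for x
      using that by (auto simp: cube_def c_def)
    then show ?case
      by (intro exI[of _ "Leaf (g c)"]) auto
  next
    case (insert j J)
    have sub: "J \<subseteq> I" and j: "j \<in> I" using insert.prems by auto
    obtain T0 where T0: "queries T0 \<subseteq> cube I"
      "\<forall>x\<in>cube I. (\<forall>i\<in>I - J. x i = (y(j := 0)) i) \<longrightarrow> run I T0 x = g x"
      using insert.IH[OF sub, of "y(j := 0)"] by blast
    obtain T1 where T1: "queries T1 \<subseteq> cube I"
      "\<forall>x\<in>cube I. (\<forall>i\<in>I - J. x i = (y(j := 1)) i) \<longrightarrow> run I T1 x = g x"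
      using insert.IH[OF sub, of "y(j := 1)"] by blast
    define a :: "'i \<Rightarrow> bit" where "a = (\<lambda>i. if i = j then 1 else 0)"
    have "a \<in> cube I" using j by (auto simp: a_def cube_def)
    moreover have ip: "ip I a x = x j" for x
    proof -
      have "ip I a x = (\<Sum>i\<in>I. if i = j then x i else 0)"
        unfolding ip_def a_def by (rule sum.cong) (auto simp del: mult_bit_eq_and)
      then show ?thesis using j assms by simp
    qed
    moreover have "run I (Query a T0 T1) x = g x"
      if x: "x \<in> cube I" "\<forall>i\<in>I - insert j J. x i = y i" for x
    proof (cases "x j = 0")
      case True
      then have "\<forall>i\<in>I - J. x i = (y(j := 0)) i" using x(2) by auto
      then show ?thesis using T0(2) x(1) True by (simp add: ip)
    next
      case False
      then have "\<forall>i\<in>I - J. x i = (y(j := 1)) i" using x(2) by auto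
      then show ?thesis using T1(2) x(1) False by (simp add: ip)
    qed
    ultimately show ?case using T0(1) T1(1)
      by (intro exI[of _ "Query a T0 T1"]) auto
  qed
  from this[of I] assms show ?thesis by (auto simp: computes_def)
qed

definition direct_power ::
    "nat \<Rightarrow> ((nat \<Rightarrow> bit) \<Rightarrow> bit) \<Rightarrow> (nat \<times> nat \<Rightarrow> bit) \<Rightarrow> (nat \<Rightarrow> bit)" where
  "direct_power k f x = (\<lambda>i. if i < k then f (\<lambda>j. x (i, j)) else 0)"

definition fourier :: "nat \<Rightarrow> ((nat \<Rightarrow> bit) \<Rightarrow> bit) \<Rightarrow> (nat \<Rightarrow> bit) \<Rightarrow> real" where
  "fourier n f z =
     (\<Sum>x\<in>cube {..<n}. of_bit (f x) * (-1) ^ (of_bit (ip {..<n} x z) :: nat)) / 2 ^ n"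

text \<open>
  If \<open>f\<close> is constant on the cube, then \<open>spar n f \<le> 1\<close> and \<open>log 2 (spar n f) = 0\<close>, where
  \<open>log 2 0 = 0\<close> by convention; its query complexity is 0, so a quotient of the two is
  \<open>0 / 0 = 0\<close>. For nonconstant \<open>f\<close>, \<open>spar n f \<ge> 2\<close>.
\<close>

definition spar :: "nat \<Rightarrow> ((nat \<Rightarrow> bit) \<Rightarrow> bit) \<Rightarrow> nat" where
  "spar n f = card {z \<in> cube {..<n}. fourier n f z \<noteq> 0}"

end

(*
  Call a set A of vectors a certificate of f at x if f is constant on the coset x + A^perp.
  For the lower bound on D(f^k), follow the path of an optimal tree on the input (x,...,x). Its
  queries certify f^k there, and projecting their solution space onto one block and passing to
  the fibre over x peels off a certificate of f at x for each block. So every x has a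
  certificate of size at most m = D(f^k) div k.

  Conversely D(f) <= m^2: after querying a 1-certificate, the remaining codimension of every
  0-certificate drops by at least one. And D(f) <= m * log spar(f): querying any certificate
  at a point merges the characters into classes, and every class has at least two members, so
  the spectrum of a nonconstant f halves.
*)

theory Submission
  imports Defs "HOL-Library.Function_Algebras"
begin

declare add_bit_eq_xor [simp del] mult_bit_eq_and [simp del]

text \<open>As simp rules these would interfere with eta-contraction.\<close>

declare plus_fun_apply [simp del] zero_fun_apply [simp del]

section \<open>Linear algebra over the field with two elements\<close>

lemma bit_add_self [simp]: "b + b = 0" for b :: bit
  by (cases b) (simp_all add: add_bit_eq_xor)

lemma bit_add_eq_0_iff [simp]: "a + b = 0 \<longleftrightarrow> a = b" for a b :: bit
  by (cases a; cases b) (simp_all add: add_bit_eq_xor)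

lemma of_bool_eq_1_bit [simp]: "of_bool (b = 1) = b" for b :: bit
  by (cases b) simp_all

lemma bit_fun_add_self [simp]: "x + x = 0" for x :: "'i \<Rightarrow> bit"
  by (simp add: fun_eq_iff plus_fun_apply zero_fun_apply)

lemma bit_fun_add_left_cancel [simp]: "x + (x + y) = y" for x y :: "'i \<Rightarrow> bit"
  by (simp flip: add.assoc)

lemma cube_add: "x + y \<in> cube I" if "x \<in> cube I" "y \<in> cube I"
  using that by (simp add: cube_def plus_fun_apply)

lemma cube_0 [simp]: "0 \<in> cube I"
  by (simp add: cube_def zero_fun_apply)

lemma bij_betw_cube: "bij_betw (\<lambda>S i. of_bool (i \<in> S)) (Pow I) (cube I)"
  by (rule bij_betw_byWitness[where f' = "\<lambda>x. {i. x i = 1}"])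
    (auto simp: cube_def fun_eq_iff)

lemma finite_cube: "finite (cube I)" if "finite I"
  using bij_betw_finite[OF bij_betw_cube[of I]] that by simp

lemma card_cube: "card (cube I) = 2 ^ card I" if "finite I"
  using bij_betw_same_card[OF bij_betw_cube[of I]] that by (simp add: card_Pow)

lemma ip_commute: "ip I a x = ip I x a"
  by (simp add: ip_def mult.commute)

lemma ip_add_right [simp]: "ip I a (x + y) = ip I a x + ip I a y"
  by (simp add: ip_def distrib_left sum.distrib plus_fun_apply)

lemma ip_add_left [simp]: "ip I (a + b) x = ip I a x + ip I b x"
  by (simp add: ip_def distrib_right sum.distrib plus_fun_apply)

lemma ip_0_right [simp]: "ip I a 0 = 0"
  by (simp add: ip_def zero_fun_apply)

lemma ip_0_left [simp]: "ip I 0 x = 0"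
  by (simp add: ip_def zero_fun_apply)

lemma ip_cong: "ip I a x = ip I b y" if "\<And>i. i \<in> I \<Longrightarrow> a i * x i = b i * y i"
  using that by (simp add: ip_def)

definition unit_vec :: "'i \<Rightarrow> 'i \<Rightarrow> bit" where
  "unit_vec j = (\<lambda>i. of_bool (i = j))"

lemma ip_unit_vec: "ip I a (unit_vec j) = a j" if "finite I" "j \<in> I"
proof -
  have "ip I a (unit_vec j) = (\<Sum>i\<in>I. if i = j then a i else 0)"
    unfolding ip_def unit_vec_def by (rule sum.cong) auto
  then show ?thesis using that by simp
qed

text \<open>This is \<open>A^perp\<close> within the cube; a vector of \<open>A\<close> may lie
  outside the cube and then acts through its coordinates in \<open>I\<close>.\<close>

definition kernel :: "'i set \<Rightarrow> ('i \<Rightarrow> bit) set \<Rightarrow> ('i \<Rightarrow> bit) set" where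
  "kernel I A = {z \<in> cube I. \<forall>a\<in>A. ip I a z = 0}"

lemma kernel_subset_cube: "kernel I A \<subseteq> cube I"
  by (auto simp: kernel_def)

lemma kernel_add: "y + z \<in> kernel I A" if "y \<in> kernel I A" "z \<in> kernel I A"
  using that by (simp add: kernel_def cube_add)

lemma zero_in_kernel [simp]: "0 \<in> kernel I A"
  by (simp add: kernel_def)

lemma kernel_Un: "kernel I (A \<union> B) = kernel I A \<inter> kernel I B"
  by (auto simp: kernel_def)

section \<open>Certificates for direct powers\<close>

text \<open>Dependent vectors are allowed in \<open>A\<close>, so \<open>card A\<close> only bounds
  the codimension of the coset from above; certificates can then be mapped and counted without
  choosing bases.\<close>

definition certifies :: "'i set \<Rightarrow> (('i \<Rightarrow> bit) \<Rightarrow> 'o) \<Rightarrow> ('i \<Rightarrow> bit) set \<Rightarrow> ('i \<Rightarrow> bit) \<Rightarrow> bool" where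
  "certifies I f A x \<longleftrightarrow> finite A \<and> (\<forall>z\<in>kernel I A. f (x + z) = f x)"

text \<open>
  Gaussian elimination of the variables in \<open>J\<close>: \<open>B\<close> describes the projection of the solution
  space along \<open>J\<close>, and \<open>C\<close> the fibres of this projection.
\<close>

lemma eliminate_variables:
  fixes A :: "('i \<Rightarrow> bit) set"
  assumes "finite J" "finite I" "J \<subseteq> I" "finite A"
  obtains B C where "finite B" "finite C" "card B + card C \<le> card A"
    "\<And>b j. b \<in> B \<Longrightarrow> j \<in> J \<Longrightarrow> b j = 0"
    "\<And>z. (\<forall>a\<in>A. ip I a z = 0) \<longleftrightarrow> (\<forall>a\<in>B \<union> C. ip I a z = 0)"
    "\<And>z. (\<forall>b\<in>B. ip I b z = 0) \<Longrightarrow> \<exists>z'. (\<forall>i. i \<notin> J \<longrightarrow> z' i = z i) \<and> (\<forall>c\<in>C. ip I c z' = 0)"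
  using assms(1,3)
proof (induction J arbitrary: thesis rule: finite_induct)
  case empty
  show ?case
    by (rule empty.prems(1)[of A "{}"]) (use assms in auto)
next
  case (insert j J)
  from insert.prems have j: "j \<in> I" and J: "J \<subseteq> I" by auto
  obtain B C where fin: "finite B" "finite C" and card: "card B + card C \<le> card A"
    and van: "\<And>b j. b \<in> B \<Longrightarrow> j \<in> J \<Longrightarrow> b j = 0"
    and eqv: "\<And>z. (\<forall>a\<in>A. ip I a z = 0) \<longleftrightarrow> (\<forall>a\<in>B \<union> C. ip I a z = 0)"
    and ext: "\<And>z. (\<forall>b\<in>B. ip I b z = 0) \<Longrightarrow>
        \<exists>z'. (\<forall>i. i \<notin> J \<longrightarrow> z' i = z i) \<and> (\<forall>c\<in>C. ip I c z' = 0)"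
    by (rule insert.IH[OF _ J]) blast
  show ?case
  proof (cases "\<forall>b\<in>B. b j = 0")
    case True
    show ?thesis
    proof (rule insert.prems(1)[of B C])
      show "b i = 0" if "b \<in> B" "i \<in> insert j J" for b i
        using that True van by auto
      show "\<exists>z'. (\<forall>i. i \<notin> insert j J \<longrightarrow> z' i = z i) \<and> (\<forall>c\<in>C. ip I c z' = 0)"
        if "\<forall>b\<in>B. ip I b z = 0" for z
        using ext[OF that] by blast
    qed (use fin card eqv in auto)
  next
    case False
    \<comment> \<open>\<open>p\<close> is the pivot for \<open>j\<close>. It moves to
      \<open>C\<close>, and adding it to the other vectors of \<open>B\<close> with a 1 at
      \<open>j\<close> clears that coordinate, so the total count does not grow.\<close>
    then obtain p where p: "p \<in> B" "p j = 1" by auto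
    define r where "r b = (if b j = 1 then b + p else b)" for b
    have r_j: "r b j = 0" for b
      using p by (auto simp: r_def plus_fun_apply)
    have r_ip: "ip I (r b) z = ip I b z" if "ip I p z = 0" for b z
      using that by (simp add: r_def)
    show ?thesis
    proof (rule insert.prems(1)[of "r ` (B - {p})" "insert p C"])
      have "card (r ` (B - {p})) \<le> card B - 1"
        using card_image_le[of "B - {p}" r] fin p by simp
      moreover have "card B > 0" using fin p by (auto simp: card_gt_0_iff)
      moreover have "card (insert p C) \<le> Suc (card C)" using fin by (simp add: card_insert_if)
      ultimately show "card (r ` (B - {p})) + card (insert p C) \<le> card A"
        using card by linarith
      show "b i = 0" if "b \<in> r ` (B - {p})" "i \<in> insert j J" for b i
      proof (cases "i = j")
        case True
        then show ?thesis using that(1) r_j by auto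
      next
        case False
        then have "i \<in> J" using that(2) by simp
        moreover obtain b' where "b' \<in> B" "b = r b'"
          using \<open>b \<in> r ` (B - {p})\<close> by blast
        ultimately show ?thesis using van[of b' i] van[OF p(1), of i] by (simp add: r_def plus_fun_apply)
      qed
      show "(\<forall>a\<in>A. ip I a z = 0) \<longleftrightarrow> (\<forall>a\<in>r ` (B - {p}) \<union> insert p C. ip I a z = 0)" for z
      proof (cases "ip I p z = 0")
        case True
        have "(\<forall>b\<in>B. ip I b z = 0) \<longleftrightarrow> (\<forall>b\<in>B - {p}. ip I (r b) z = 0)"
          unfolding r_ip[OF True] using True by blast
        then show ?thesis unfolding eqv using True by (auto simp: ball_Un)
      next
        case False
        then show ?thesis unfolding eqv using p(1) by auto
      qed
      fix z assume z: "\<forall>b\<in>r ` (B - {p}). ip I b z = 0"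
      \<comment> \<open>Flipping coordinate \<open>j\<close> repairs the pivot equation, while the
        vectors \<open>r b\<close> vanish at \<open>j\<close> and do not notice the flip.\<close>
      define z1 where "z1 = (if ip I p z = 0 then z else z + unit_vec j)"
      have pz1: "ip I p z1 = 0"
        using p(2) ip_unit_vec[OF assms(2) j] by (simp add: z1_def)
      have "ip I b z1 = 0" if "b \<in> B" for b
      proof (cases "b = p")
        case False
        then have "ip I (r b) z = 0" using z that by auto
        then have "ip I (r b) z1 = 0"
          using r_j[of b] ip_unit_vec[OF assms(2) j] by (simp add: z1_def)
        then show ?thesis using r_ip[OF pz1] by simp
      qed (use pz1 in simp)
      then obtain z' where z': "\<And>i. i \<notin> J \<Longrightarrow> z' i = z1 i" "\<forall>c\<in>C. ip I c z' = 0"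
        using ext[of z1] by blast
      \<comment> \<open>\<open>z'\<close> and \<open>z1\<close> differ only on \<open>J\<close>,
        where \<open>p\<close> vanishes because it came from \<open>B\<close>.\<close>
      have "ip I p z' = ip I p z1"
        by (rule ip_cong) (metis van[OF p(1)] z'(1) mult_zero_left)
      moreover have "z' i = z i" if "i \<notin> insert j J" for i
        using that z'(1)[of i] by (simp add: z1_def unit_vec_def plus_fun_apply)
      ultimately show "\<exists>z'. (\<forall>i. i \<notin> insert j J \<longrightarrow> z' i = z i) \<and> (\<forall>c\<in>insert p C. ip I c z' = 0)"
        using pz1 z'(2) by auto
    qed (use fin in auto)
  qed
qed

text \<open>Induction on the blocks: eliminating all blocks but \<open>s\<close> leaves constraints
  \<open>B\<close> on block \<open>s\<close> alone, which certify \<open>f\<close> at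
  \<open>x\<close> and hence number at least \<open>m\<close>, and constraints \<open>C\<close>,
  which take the role of \<open>A\<close> for the other blocks.\<close>

lemma direct_power_certificate:
  fixes f :: "('i \<Rightarrow> bit) \<Rightarrow> 'o"
  assumes "finite S" "finite I" "finite A"
    and cert: "\<And>z s. z \<in> kernel (S \<times> I) A \<Longrightarrow> s \<in> S \<Longrightarrow> f (x + (\<lambda>i. z (s, i))) = f x"
    and min: "\<And>B. certifies I f B x \<Longrightarrow> m \<le> card B"
  shows "card S * m \<le> card A"
  using assms(1,3) cert
proof (induction S arbitrary: A rule: finite_induct)
  case (insert s S)
  let ?I = "insert s S \<times> I" and ?J = "S \<times> I"
  have fin: "finite ?I" "finite ?J" "?J \<subseteq> ?I"
    using insert.hyps assms(2) by auto
  obtain B C where BC: "finite B" "finite C" "card B + card C \<le> card A"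
    and van: "\<And>b j. b \<in> B \<Longrightarrow> j \<in> ?J \<Longrightarrow> b j = 0"
    and eqv: "\<And>z. (\<forall>a\<in>A. ip ?I a z = 0) \<longleftrightarrow> (\<forall>a\<in>B \<union> C. ip ?I a z = 0)"
    and ext: "\<And>z. (\<forall>b\<in>B. ip ?I b z = 0) \<Longrightarrow>
        \<exists>z'. (\<forall>i. i \<notin> ?J \<longrightarrow> z' i = z i) \<and> (\<forall>c\<in>C. ip ?I c z' = 0)"
    using eliminate_variables[OF fin(2,1,3) insert.prems(1)] by blast
  have split: "ip ?I a z = ip I (\<lambda>i. a (s, i)) (\<lambda>i. z (s, i)) + ip ?J a z" for a z
  proof -
    have "?I = (Pair s ` I) \<union> ?J" by auto
    then have "ip ?I a z = ip (Pair s ` I) a z + ip ?J a z"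
      unfolding ip_def using insert.hyps assms(2) by (simp only:) (intro sum.union_disjoint; auto)
    also have "ip (Pair s ` I) a z = ip I (\<lambda>i. a (s, i)) (\<lambda>i. z (s, i))"
      unfolding ip_def by (subst sum.reindex) (auto simp: inj_on_def)
    finally show ?thesis .
  qed
  have B_J: "ip ?J b z = 0" if "b \<in> B" for b z
    using van[OF that] unfolding ip_def by (intro sum.neutral) auto
  then have B_ip: "ip ?I b z = ip I (\<lambda>i. b (s, i)) (\<lambda>i. z (s, i))" if "b \<in> B" for b z
    using that by (simp add: split)
  let ?B = "(\<lambda>b i. b (s, i)) ` B"
  have "certifies I f ?B x"
    unfolding certifies_def
  proof (intro conjI ballI)
    fix z assume z: "z \<in> kernel I ?B"
    \<comment> \<open>Padding \<open>z\<close> by zeros and then correcting the other blocks gives a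
      solution of all of \<open>A\<close> whose block \<open>s\<close> is still
      \<open>z\<close>.\<close>
    define y where "y = (\<lambda>(t, i). if t = s then z i else 0)"
    have "\<forall>b\<in>B. ip ?I b y = 0"
      using z by (auto simp: B_ip y_def kernel_def)
    then obtain y' where y': "\<And>i. i \<notin> ?J \<Longrightarrow> y' i = y i" "\<forall>c\<in>C. ip ?I c y' = 0"
      using ext[of y] by blast
    have ys: "(\<lambda>i. y' (s, i)) = z"
      using y'(1) insert.hyps by (auto simp: y_def fun_eq_iff)
    have "y' \<in> cube ?I"
      using y'(1) z by (auto simp: cube_def y_def kernel_def)
    moreover have "\<forall>b\<in>B. ip ?I b y' = 0"
      using z ys by (auto simp: B_ip kernel_def)
    ultimately have "y' \<in> kernel ?I A"
      using y'(2) eqv[of y'] by (auto simp: kernel_def)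
    from insert.prems(2)[OF this insertI1] show "f (x + z) = f x"
      by (simp only: ys)
  qed (use BC in auto)
  then have mB: "m \<le> card B"
    using min card_image_le[OF BC(1)] le_trans by blast
  \<comment> \<open>On the fibre where block \<open>s\<close> is zero the equations of
    \<open>B\<close> hold automatically, so solving \<open>C\<close> there suffices for solving
    \<open>A\<close>.\<close>
  have "card S * m \<le> card C"
  proof (rule insert.IH[OF BC(2)])
    fix z t assume z: "z \<in> kernel ?J C" and t: "t \<in> S"
    have zs: "(\<lambda>i. z (s, i)) = 0"
      using z insert.hyps by (auto simp: kernel_def cube_def fun_eq_iff zero_fun_apply)
    have "ip ?I a z = 0" if "a \<in> B \<union> C" for a
      using that z by (auto simp: B_J zs split kernel_def)
    moreover have "z \<in> cube ?I" using z by (auto simp: kernel_def cube_def)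
    ultimately have "z \<in> kernel ?I A" using eqv[of z] by (auto simp: kernel_def)
    then show "f (x + (\<lambda>i. z (t, i))) = f x" using insert.prems(2) t by blast
  qed
  then show ?case using mB BC insert.hyps by simp
qed simp

text \<open>\<open>A\<close> collects the queries on the path of \<open>x\<close>; an input with the
  same answers follows the same path.\<close>

lemma run_path_certificate:
  "\<exists>A. finite A \<and> card A \<le> depth T \<and>
    (\<forall>y. (\<forall>a\<in>A. ip I a y = ip I a x) \<longrightarrow> run I T y = run I T x)"
proof (induction T)
  case (Leaf c)
  show ?case by (rule exI[of _ "{}"]) auto
next
  case (Query a T0 T1)
  define T where "T = (if ip I a x = 0 then T0 else T1)"
  have "\<exists>A. finite A \<and> card A \<le> depth T \<and>
      (\<forall>y. (\<forall>a\<in>A. ip I a y = ip I a x) \<longrightarrow> run I T y = run I T x)"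
    using Query.IH by (simp add: T_def)
  then obtain A where A: "finite A" "card A \<le> depth T"
    "\<And>y. (\<forall>a\<in>A. ip I a y = ip I a x) \<Longrightarrow> run I T y = run I T x"
    by blast
  have "depth T \<le> max (depth T0) (depth T1)" by (simp add: T_def)
  moreover have "card (insert a A) \<le> Suc (card A)" using A by (simp add: card_insert_if)
  ultimately have "card (insert a A) \<le> depth (Query a T0 T1)" using A(2) by simp
  moreover have "run I (Query a T0 T1) y = run I (Query a T0 T1) x"
    if y: "\<forall>b\<in>insert a A. ip I b y = ip I b x" for y
  proof -
    have "run I T y = run I T x" using y by (intro A(3)) simp
    moreover have "ip I a y = ip I a x" using y by simp
    ultimately show ?thesis by (cases "ip I a x = 0") (simp_all add: T_def)
  qed
  moreover have "finite (insert a A)" using A(1) by simp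
  ultimately show ?case by blast
qed

lemma pdt_complexity_attained:
  assumes "finite I"
  obtains T where "computes I T g" "depth T = pdt_complexity I g"
  using LeastI_ex[of "\<lambda>d. \<exists>T. computes I T g \<and> depth T = d"] computes_exists[OF assms, of g]
  unfolding pdt_complexity_def by blast

lemma pdt_complexity_le: "pdt_complexity I g \<le> depth T" if "computes I T g"
  unfolding pdt_complexity_def using that by (intro Least_le) blast

text \<open>With \<open>x\<close> placed in every block, the queries on a single path must number at
  least \<open>k\<close> times the size of a smallest certificate of \<open>f\<close> at
  \<open>x\<close>.\<close>

lemma certificate_of_direct_power:
  fixes f :: "(nat \<Rightarrow> bit) \<Rightarrow> bit"
  assumes "x \<in> cube {..<n}"
  obtains A where "certifies {..<n} f A x"
    "k * card A \<le> pdt_complexity ({..<k} \<times> {..<n}) (direct_power k f)"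
proof -
  let ?I = "{..<k} \<times> {..<n}"
  obtain T where T: "computes ?I T (direct_power k f)"
      "depth T = pdt_complexity ?I (direct_power k f)"
    by (rule pdt_complexity_attained[of ?I]) auto
  define X where "X = (\<lambda>(i, j). if i < k then x j else 0)"
  have X: "X \<in> cube ?I" using assms by (auto simp: cube_def X_def)
  obtain A where A: "finite A" "card A \<le> depth T"
    and path: "\<And>y. (\<forall>a\<in>A. ip ?I a y = ip ?I a X) \<Longrightarrow> run ?I T y = run ?I T X"
    using run_path_certificate[of T ?I X] by blast
  have run: "run ?I T y = direct_power k f y" if "y \<in> cube ?I" for y
    using T(1) that by (simp add: computes_def)
  define m where "m = (LEAST m. \<exists>B. certifies {..<n} f B x \<and> card B = m)"
  \<comment> \<open>Fixing every coordinate leaves only the zero shift, so some certificate exists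
    and the minimum \<open>m\<close> is attained.\<close>
  have "certifies {..<n} f (unit_vec ` {..<n}) x"
  proof -
    have "z = 0" if "z \<in> kernel {..<n} (unit_vec ` {..<n})" for z
      using that by (auto simp: kernel_def cube_def fun_eq_iff zero_fun_apply
        ip_commute[of _ "unit_vec _"] ip_unit_vec)
    then show ?thesis by (metis certifies_def add_0_right finite_imageI finite_lessThan)
  qed
  then have ex: "\<exists>m B. certifies {..<n} f B x \<and> card B = m" by blast
  obtain B where B: "certifies {..<n} f B x" "card B = m"
    using LeastI_ex[OF ex] unfolding m_def by blast
  have "card {..<k} * m \<le> card A"
  proof (rule direct_power_certificate[where I = "{..<n}" and f = f and x = x])
    fix z s assume z: "z \<in> kernel ?I A" and s: "s \<in> {..<k}"
    \<comment> \<open>A shift by \<open>z\<close> changes no answer on the path; output bit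
      \<open>s\<close> then isolates block \<open>s\<close>.\<close>
    have "direct_power k f (X + z) = direct_power k f X"
      using path[of "X + z"] run[OF X] run[of "X + z"] X z by (simp add: kernel_def cube_add)
    then have "direct_power k f (X + z) s = direct_power k f X s" by simp
    then have "f (\<lambda>j. (X + z) (s, j)) = f (\<lambda>j. X (s, j))"
      using s unfolding direct_power_def by simp
    moreover have "(\<lambda>j. (X + z) (s, j)) = x + (\<lambda>i. z (s, i))" "(\<lambda>j. X (s, j)) = x"
      using s by (auto simp: X_def fun_eq_iff plus_fun_apply)
    ultimately show "f (x + (\<lambda>i. z (s, i))) = f x"
      by (simp only:)
  next
    show "m \<le> card B" if "certifies {..<n} f B x" for B
      unfolding m_def using that by (intro Least_le) blast
  qed (use A in auto)
  then show ?thesis using that[OF B(1)] B(2) A(2) T(2) by simp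
qed

section \<open>Building trees from certificates\<close>

text \<open>The set \<open>V\<close> holds the inputs consistent with the answers so far; for
  \<open>V = cube I\<close> the budget \<open>r\<close> bounds
  \<open>pdt_complexity I f\<close>.\<close>

definition decidable_on ::
    "'i set \<Rightarrow> (('i \<Rightarrow> bit) \<Rightarrow> 'o) \<Rightarrow> ('i \<Rightarrow> bit) set \<Rightarrow> nat \<Rightarrow> bool" where
  "decidable_on I f V r \<longleftrightarrow>
    (\<exists>T. queries T \<subseteq> cube I \<and> depth T \<le> r \<and> (\<forall>x\<in>V. run I T x = f x))"

lemma decidable_on_const: "decidable_on I f V r" if "\<And>x. x \<in> V \<Longrightarrow> f x = c"
  unfolding decidable_on_def using that by (intro exI[of _ "Leaf c"]) auto

lemma decidable_on_mono: "decidable_on I f V r'" if "decidable_on I f V r" "r \<le> r'"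
  using that unfolding decidable_on_def by (meson le_trans)

text \<open>All of \<open>B\<close> is queried regardless of the answers, and each answer pattern
  that occurs in \<open>V\<close> continues with its own tree of depth at most
  \<open>r\<close>.\<close>

lemma decidable_on_query_all:
  assumes "finite B"
    and "\<And>x. x \<in> V \<Longrightarrow> decidable_on I f {y \<in> V. \<forall>a\<in>B. ip I a y = ip I a x} r"
  shows "decidable_on I f V (card B + r)"
  using assms
proof (induction B arbitrary: V rule: finite_induct)
  case empty
  show ?case
  \<comment> \<open>An empty \<open>V\<close> realizes no answer pattern, so the hypothesis supplies
    no tree; any leaf serves.\<close>
  proof (cases "V = {}")
    case True
    then show ?thesis by (intro decidable_on_const) auto
  next
    case False
    then show ?thesis using empty by auto
  qed
next
  case (insert a B)
  have "decidable_on I f {y \<in> V. ip I a y = e} (card B + r)" for e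
  proof (rule insert.IH)
    fix x assume x: "x \<in> {y \<in> V. ip I a y = e}"
    then have eq: "{y \<in> {y \<in> V. ip I a y = e}. \<forall>b\<in>B. ip I b y = ip I b x}
        = {y \<in> V. \<forall>b\<in>insert a B. ip I b y = ip I b x}"
      by auto
    then show "decidable_on I f {y \<in> {y \<in> V. ip I a y = e}. \<forall>b\<in>B. ip I b y = ip I b x} r"
      unfolding eq using x by (intro insert.prems) simp
  qed
  from this[of 0] this[of 1] obtain T0 T1 where T:
    "queries T0 \<subseteq> cube I" "depth T0 \<le> card B + r" "\<forall>y\<in>V. ip I a y = 0 \<longrightarrow> run I T0 y = f y"
    "queries T1 \<subseteq> cube I" "depth T1 \<le> card B + r" "\<forall>y\<in>V. ip I a y = 1 \<longrightarrow> run I T1 y = f y"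
    unfolding decidable_on_def by blast
  \<comment> \<open>Labels of a tree must lie in the cube; truncating \<open>a\<close> to
    \<open>I\<close> does not change its inner products.\<close>
  let ?a = "\<lambda>i. if i \<in> I then a i else 0"
  have "ip I ?a y = ip I a y" for y
    by (rule ip_cong) simp
  moreover have "?a \<in> cube I" by (simp add: cube_def)
  ultimately show ?case
    unfolding decidable_on_def using T insert.hyps
    by (intro exI[of _ "Query ?a T0 T1"]) auto
qed

text \<open>Phrased through answers, so that further queries just enlarge \<open>Q\<close>. Since
  \<open>x + y\<close> is also the difference of \<open>x\<close> and \<open>y\<close>, this is
  \<open>x + kernel I Q\<close> for \<open>x\<close> in the cube.\<close>

definition coset :: "'i set \<Rightarrow> ('i \<Rightarrow> bit) set \<Rightarrow> ('i \<Rightarrow> bit) \<Rightarrow> ('i \<Rightarrow> bit) set" where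
  "coset I Q x = {y \<in> cube I. \<forall>a\<in>Q. ip I a y = ip I a x}"

lemma coset_iff_kernel: "y \<in> coset I Q x \<longleftrightarrow> x + y \<in> kernel I Q" if "x \<in> cube I"
proof -
  have "y \<in> cube I \<longleftrightarrow> x + y \<in> cube I"
    using cube_add[OF that, of y] cube_add[OF that, of "x + y"] by auto
  then show ?thesis by (auto simp: coset_def kernel_def)
qed

lemma coset_refine:
  "{y \<in> coset I Q x. \<forall>a\<in>B. ip I a y = ip I a x'} = coset I (Q \<union> B) x'" if "x' \<in> coset I Q x"
  using that by (auto simp: coset_def)

lemma coset_subset_cube: "coset I Q x \<subseteq> cube I"
  by (auto simp: coset_def)

text \<open>The hypothesis \<open>dual\<close> provides a dual family for \<open>A\<close> inside
  \<open>K\<close>; summing its members over those \<open>a\<close> with \<open>ip I a u = 1\<close>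
  gives \<open>z\<close>. In contraposition, a failed interpolation exhibits an \<open>a\<close>
  implied on \<open>K\<close> by the rest of \<open>A\<close>.\<close>

lemma interpolate_independent:
  assumes "finite A" "0 \<in> K" "\<And>y z. y \<in> K \<Longrightarrow> z \<in> K \<Longrightarrow> y + z \<in> K"
    and dual: "\<And>a. a \<in> A \<Longrightarrow> \<exists>z\<in>K. (\<forall>b\<in>A - {a}. ip I b z = 0) \<and> ip I a z = 1"
  shows "\<exists>z\<in>K. \<forall>a\<in>A. ip I a z = ip I a u"
proof -
  have "\<exists>z\<in>K. \<forall>a\<in>A. ip I a z = (if a \<in> S then ip I a u else 0)" if "finite S" "S \<subseteq> A" for S
    using that
  proof (induction S rule: finite_induct)
    case empty
    show ?case using assms(2) by (intro bexI[of _ 0] ballI) (simp_all only: empty_iff if_False ip_0_right)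
  next
    case (insert s S)
    then obtain z where z: "z \<in> K" "\<forall>a\<in>A. ip I a z = (if a \<in> S then ip I a u else 0)" by auto
    obtain y where y: "y \<in> K" "\<forall>b\<in>A - {s}. ip I b y = 0" "ip I s y = 1"
      using dual[of s] insert.prems by auto
    show ?case
    proof (cases "ip I s u = 0")
      case True
      then show ?thesis using z insert.hyps by (intro bexI[of _ z]) auto
    next
      case False
      have "ip I a (z + y) = (if a \<in> insert s S then ip I a u else 0)" if "a \<in> A" for a
        using that z(2) y(2,3) insert.hyps False by (cases "a = s") auto
      then show ?thesis using assms(3)[OF z(1) y(1)] by blast
    qed
  qed
  from this[OF assms(1)] show ?thesis by auto
qed

text \<open>
  Querying a 1-certificate \<open>B\<close> makes a vector of every 0-certificate redundant, since the
  affine spaces of a 0-certificate and of a 1-certificate are disjoint.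
\<close>

lemma decidable_on_rounds:
  fixes f :: "('i \<Rightarrow> bit) \<Rightarrow> bit"
  assumes cert: "\<And>x. x \<in> cube I \<Longrightarrow> \<exists>A. certifies I f A x \<and> card A \<le> m"
    and "x \<in> cube I"
    and "\<And>y. y \<in> coset I Q x \<Longrightarrow> f y = 0 \<Longrightarrow>
      \<exists>A. finite A \<and> card A \<le> c \<and> (\<forall>z\<in>kernel I (Q \<union> A). f (y + z) = 0)"
  shows "decidable_on I f (coset I Q x) (c * m)"
  using assms(2-)
proof (induction c arbitrary: Q x)
  case 0
  show ?case
  \<comment> \<open>With no constraints left to add, a single zero of \<open>f\<close> forces
    \<open>f\<close> to vanish on the whole coset.\<close>
  proof (cases "\<exists>y\<in>coset I Q x. f y = 0")
    case True
    then obtain y where y: "y \<in> coset I Q x" "f y = 0" by blast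
    with 0 obtain A where "finite A" "card A \<le> 0" "\<forall>z\<in>kernel I (Q \<union> A). f (y + z) = 0" by blast
    then have zero: "\<forall>z\<in>kernel I Q. f (y + z) = 0" by simp
    have "f y' = 0" if "y' \<in> coset I Q x" for y'
    proof -
      have "y + y' \<in> kernel I Q"
        using kernel_add[of "x + y" I Q "x + y'"] that y(1) coset_iff_kernel[OF 0(1)]
        by (simp add: ac_simps)
      then show ?thesis using zero by force
    qed
    then show ?thesis by (rule decidable_on_const)
  next
    case False
    then show ?thesis by (intro decidable_on_const[where c = 1]) auto
  qed
next
  case (Suc c)
  show ?case
  proof (cases "\<exists>y\<in>coset I Q x. f y = 1")
    case False
    then show ?thesis by (intro decidable_on_const[where c = 0]) auto
  next
    case True
    then obtain y1 where y1: "y1 \<in> coset I Q x" "f y1 = 1" by blast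
    then obtain B where "certifies I f B y1" and card_B: "card B \<le> m"
      using cert coset_subset_cube by blast
    then have B: "finite B" "\<And>z. z \<in> kernel I B \<Longrightarrow> f (y1 + z) = 1"
      using y1 by (auto simp: certifies_def)
    have "decidable_on I f (coset I Q x) (card B + c * m)"
    proof (rule decidable_on_query_all[OF B(1)])
      \<comment> \<open>The answers to \<open>B\<close> may differ from those at \<open>y1\<close>:
        the redundancy shown below concerns only the linear space
        \<open>kernel I (Q \<union> B)\<close>, so progress is made on every branch.\<close>
      fix x' assume x': "x' \<in> coset I Q x"
      have "decidable_on I f (coset I (Q \<union> B) x') (c * m)"
      proof (rule Suc.IH)
        show "x' \<in> cube I" using x' coset_subset_cube by blast
        fix y assume "y \<in> coset I (Q \<union> B) x'" and fy: "f y = 0"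
        with x' have y: "y \<in> coset I Q x" by (auto simp: coset_def)
        obtain A where A: "finite A" "card A \<le> Suc c"
          and zero: "\<And>z. z \<in> kernel I (Q \<union> A) \<Longrightarrow> f (y + z) = 0"
          using Suc.prems(2)[OF y fy] by blast
        define u where "u = y + y1"
        have u: "u \<in> kernel I Q"
          using kernel_add[of "x + y" I Q "x + y1"] y y1(1) coset_iff_kernel[OF Suc.prems(1)]
          by (simp add: ac_simps u_def)
        \<comment> \<open>Otherwise some \<open>z\<close> in \<open>kernel I (Q \<union> B)\<close>
          matches \<open>u\<close> on \<open>A\<close>, and \<open>y1 + z = y + (u + z)\<close>
          would be a common point of the two certified affine spaces.\<close>
        have "\<exists>a\<in>A. \<forall>z\<in>kernel I (Q \<union> B). (\<forall>b\<in>A - {a}. ip I b z = 0) \<longrightarrow> ip I a z = 0"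
        proof (rule ccontr)
          assume "\<not> ?thesis"
          then have "\<exists>z\<in>kernel I (Q \<union> B). \<forall>a\<in>A. ip I a z = ip I a u"
            by (intro interpolate_independent[OF A(1)]) (auto intro: kernel_add)
          then obtain z where z: "z \<in> kernel I (Q \<union> B)" "\<forall>a\<in>A. ip I a z = ip I a u" by blast
          have "u + z \<in> kernel I Q"
            using u z(1) by (simp add: kernel_add kernel_Un)
          then have "u + z \<in> kernel I (Q \<union> A)"
            using z(2) by (auto simp: kernel_def)
          then have "f (y + (u + z)) = 0" by (rule zero)
          moreover have "y + (u + z) = y1 + z"
            by (simp add: u_def add.assoc)
          moreover have "f (y1 + z) = 1"
            using z(1) by (intro B(2)) (simp add: kernel_Un)
          ultimately show False by simp
        qed
        then obtain a where a: "a \<in> A"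
          "\<And>z. z \<in> kernel I (Q \<union> B) \<Longrightarrow> \<forall>b\<in>A - {a}. ip I b z = 0 \<Longrightarrow> ip I a z = 0"
          by blast
        have "f (y + z) = 0" if "z \<in> kernel I (Q \<union> B \<union> (A - {a}))" for z
        proof (rule zero)
          have "ip I a z = 0" using that a(2)[of z] by (simp add: kernel_def)
          then show "z \<in> kernel I (Q \<union> A)" using that by (auto simp: kernel_def)
        qed
        moreover have "card (A - {a}) \<le> c" using A a(1) by simp
        ultimately show "\<exists>A. finite A \<and> card A \<le> c \<and>
            (\<forall>z\<in>kernel I (Q \<union> B \<union> A). f (y + z) = 0)"
          using A(1) by blast
      qed
      then show "decidable_on I f {y \<in> coset I Q x. \<forall>a\<in>B. ip I a y = ip I a x'} (c * m)"
        by (simp add: coset_refine[OF x'])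
    qed
    then show ?thesis by (rule decidable_on_mono) (use card_B in simp)
  qed
qed

section \<open>Spectra on cosets\<close>

definition character :: "'i set \<Rightarrow> ('i \<Rightarrow> bit) \<Rightarrow> ('i \<Rightarrow> bit) \<Rightarrow> real" where
  "character I z x = (if ip I z x = 0 then 1 else - 1)"

lemma character_add_right: "character I z (x + y) = character I z x * character I z y"
  by (cases "ip I z x"; cases "ip I z y") (simp_all add: character_def)

lemma character_add_left: "character I (y + z) x = character I y x * character I z x"
  by (cases "ip I y x"; cases "ip I z x") (simp_all add: character_def)

lemma character_commute: "character I z x = character I x z"
  by (simp add: character_def ip_commute)

text \<open>Translation by \<open>u\<close> permutes the kernel and flips the sign of the
  character.\<close>

lemma sum_character_kernel_eq_0:
  assumes "u \<in> kernel I Q" "ip I z u = 1"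
  shows "(\<Sum>w\<in>kernel I Q. character I z w) = 0"
proof -
  have "bij_betw ((+) u) (kernel I Q) (kernel I Q)"
    by (rule bij_betw_byWitness[where f' = "(+) u"]) (auto intro: kernel_add[OF assms(1)])
  then have "(\<Sum>w\<in>kernel I Q. character I z w) = (\<Sum>w\<in>kernel I Q. character I z (u + w))"
    by (rule sum.reindex_bij_betw[symmetric])
  also have "\<dots> = - (\<Sum>w\<in>kernel I Q. character I z w)"
    using assms(2) by (simp add: character_add_right character_def[of I z u] sum_negf)
  finally show ?thesis by simp
qed

lemma finite_kernel: "finite (kernel I Q)" if "finite I"
  using finite_subset[OF kernel_subset_cube finite_cube[OF that]] .

lemma card_kernel_pos: "card (kernel I Q) > 0" if "finite I"
  using finite_kernel[OF that] zero_in_kernel[of I Q] card_gt_0_iff by blast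

text \<open>The constant character is not counted in \<open>t\<close>.\<close>

definition sparse_on ::
    "'i set \<Rightarrow> (('i \<Rightarrow> bit) \<Rightarrow> bit) \<Rightarrow> ('i \<Rightarrow> bit) set \<Rightarrow> ('i \<Rightarrow> bit) \<Rightarrow> nat \<Rightarrow> bool" where
  "sparse_on I f Q x t \<longleftrightarrow> (\<exists>Z c0 c. finite Z \<and> card Z \<le> t \<and>
     (\<forall>w\<in>kernel I Q. of_bit (f (x + w)) = c0 + (\<Sum>z\<in>Z. c z * character I z w)))"

text \<open>
  Merging characters that agree on \<open>kernel I (Q \<union> B)\<close>: a class of a nontrivial character with
  a single member would give a nonzero Fourier coefficient of a constant, and if only the
  constant character became trivial, then \<open>f\<close> would have the same mean \<open>f x\<close> on both cosets.
\<close>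

lemma sparse_on_halve:
  fixes f :: "('i \<Rightarrow> bit) \<Rightarrow> bit"
  assumes "finite I" and sparse: "sparse_on I f Q x t"
    and cert: "certifies I f B x"
    and nonconst: "\<exists>w\<in>kernel I Q. f (x + w) \<noteq> f x"
    and u: "u \<in> kernel I Q"
  shows "t > 0 \<and> sparse_on I f (Q \<union> B) (x + u) ((t - 1) div 2)"
proof -
  \<comment> \<open>Taking a shortest representation makes every coefficient nonzero and every
    character in \<open>Z\<close> nontrivial on \<open>?L\<close>: any other term could be absorbed
    into \<open>c0\<close>.\<close>
  define s where "s = (LEAST s. sparse_on I f Q x s)"
  have "s \<le> t" unfolding s_def using sparse by (rule Least_le)
  have "sparse_on I f Q x s" unfolding s_def using sparse by (rule LeastI)
  then obtain Z c0 c where Z: "finite Z" "card Z \<le> s"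
    and F: "\<And>w. w \<in> kernel I Q \<Longrightarrow>
      of_bit (f (x + w)) = c0 + (\<Sum>z\<in>Z. c z * character I z w)"
    unfolding sparse_on_def by blast
  let ?L = "kernel I Q" and ?K = "kernel I (Q \<union> B)"
  have KL: "?K \<subseteq> ?L" by (auto simp: kernel_Un)
  have fin: "finite ?L" "finite ?K" using finite_kernel[OF assms(1)] by auto
  have cpos: "card ?L > 0" "card ?K > 0" using card_kernel_pos[OF assms(1)] by auto
  have minimal: "\<exists>w\<in>?L. c z * character I z w \<noteq> c z" if z: "z \<in> Z" for z
  proof (rule ccontr)
    assume "\<not> ?thesis"
    then have "of_bit (f (x + w)) = (c0 + c z) + (\<Sum>z\<in>Z - {z}. c z * character I z w)"
      if "w \<in> ?L" for w
    proof -
      have "c z * character I z w = c z"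
        using \<open>\<not> (\<exists>w\<in>?L. c z * character I z w \<noteq> c z)\<close> that by blast
      then show ?thesis using F[OF that] by (simp only: sum.remove[OF Z(1) z] add.assoc)
    qed
    moreover have "card (Z - {z}) \<le> s - 1" using Z z by simp
    ultimately have "sparse_on I f Q x (s - 1)"
      unfolding sparse_on_def using Z(1) by blast
    then have "s \<le> s - 1" unfolding s_def by (rule Least_le)
    moreover have "card Z > 0" using z Z(1) by (auto simp: card_gt_0_iff)
    ultimately show False using Z(2) by linarith
  qed
  have c_nz: "c z \<noteq> 0" if "z \<in> Z" for z
    using minimal[OF that] by auto
  have nontriv: "\<exists>w\<in>?L. ip I z w = 1" if "z \<in> Z" for z
    using minimal[OF that] by (auto simp: character_def split: if_splits)
  define b :: real where "b = of_bit (f x)"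
  have F_K: "of_bit (f (x + w)) = b" if "w \<in> ?K" for w
    using cert that by (simp add: certifies_def kernel_Un b_def)
  define Z0 where "Z0 = {z \<in> Z. \<forall>w\<in>?K. ip I z w = 0}"
  define Z1 where "Z1 = Z - Z0"
  have nontriv1: "\<exists>w\<in>?K. ip I z w = 1" if "z \<in> Z1" for z
    using that by (auto simp: Z1_def Z0_def)
  have "Z0 \<noteq> {}"
  proof
    assume "Z0 = {}"
    \<comment> \<open>Nontrivial characters sum to zero over \<open>M\<close>, so the mean of
      \<open>f\<close> on \<open>x + M\<close> is the constant term \<open>c0\<close>.\<close>
    have mean: "(\<Sum>w\<in>M. of_bit (f (x + w))) = card M * c0"
      if "M = kernel I R" "M \<subseteq> ?L" "\<And>z. z \<in> Z \<Longrightarrow> \<exists>w\<in>M. ip I z w = 1" for M R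
    proof -
      have "(\<Sum>w\<in>M. of_bit (f (x + w))) = (\<Sum>w\<in>M. c0 + (\<Sum>z\<in>Z. c z * character I z w))"
        using that(2) by (intro sum.cong refl F) (rule subsetD)
      also have "\<dots> = card M * c0 + (\<Sum>z\<in>Z. c z * (\<Sum>w\<in>M. character I z w))"
        by (simp add: sum.distrib sum_distrib_left sum.swap[of _ M])
      also have "(\<Sum>z\<in>Z. c z * (\<Sum>w\<in>M. character I z w)) = 0"
        using that(3) sum_character_kernel_eq_0 unfolding that(1)
        by (intro sum.neutral ballI) fastforce
      finally show ?thesis by simp
    qed
    have "card ?K * b = card ?K * c0"
      using mean[OF refl KL] nontriv1 \<open>Z0 = {}\<close> F_K by (simp add: Z1_def)
    then have "b = c0" using cpos by simp
    then have "(\<Sum>w\<in>?L. of_bit (f (x + w)) - b) = 0"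
      using mean[OF refl subset_refl] nontriv by (simp add: sum_subtractf)
    \<comment> \<open>As \<open>f\<close> is Boolean, its difference from \<open>b\<close> never
      changes sign, and \<open>1 - 2 * b\<close> is that sign; a zero sum thus makes every term
      vanish.\<close>
    moreover have "(\<Sum>w\<in>?L. of_bit (f (x + w)) - b) = (1 - 2 * b) * (\<Sum>w\<in>?L. \<bar>of_bit (f (x + w)) - b\<bar>)"
      by (cases "f x") (auto simp: b_def sum_distrib_left intro!: sum.cong)
    ultimately have "(\<Sum>w\<in>?L. \<bar>of_bit (f (x + w)) - b\<bar>) = 0"
      by (cases "f x") (auto simp: b_def)
    then have eq: "\<forall>w\<in>?L. of_bit (f (x + w)) = b"
      using fin(1) by (simp add: sum_nonneg_eq_0_iff)
    have "f (x + w) = f x" if "w \<in> ?L" for w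
      using bspec[OF eq that] by (cases "f (x + w)"; cases "f x") (auto simp: b_def)
    then show False using nonconst by blast
  qed
  moreover have "finite Z0" using Z(1) by (simp add: Z0_def)
  ultimately have "card Z0 > 0" by (simp add: card_gt_0_iff)
  moreover have "card Z = card Z0 + card Z1"
    unfolding Z1_def using Z(1) by (simp add: Z0_def card_Diff_subset card_mono)
  ultimately have card_Z1: "card Z1 \<le> t - 1" "t > 0" using Z(2) \<open>s \<le> t\<close> by linarith+
  define eqv where "eqv z z' \<longleftrightarrow> (\<forall>w\<in>?K. ip I z w = ip I z' w)" for z z'
  have twin: "\<exists>z'\<in>Z1. z' \<noteq> z \<and> eqv z' z" if z: "z \<in> Z1" for z
  proof (rule ccontr)
    assume no: "\<not> ?thesis"
    have "(\<Sum>w\<in>?K. character I z w) = 0"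
      using nontriv1[OF z] sum_character_kernel_eq_0 by blast
    \<comment> \<open>On \<open>?K\<close> the combination of characters is the constant
      \<open>b - c0\<close>, which has correlation 0 with the nontrivial character of
      \<open>z\<close>; without a twin only the term \<open>z' = z\<close> survives.\<close>
    then have "0 = (\<Sum>w\<in>?K. (b - c0) * character I z w)"
      by (simp flip: sum_distrib_left)
    also have "\<dots> = (\<Sum>w\<in>?K. \<Sum>z'\<in>Z. c z' * character I (z' + z) w)"
    proof (rule sum.cong[OF refl])
      fix w assume "w \<in> ?K"
      then have "b - c0 = (\<Sum>z'\<in>Z. c z' * character I z' w)"
        using F[of w] F_K[of w] KL by auto
      then show "(b - c0) * character I z w = (\<Sum>z'\<in>Z. c z' * character I (z' + z) w)"
        by (simp add: character_add_left sum_distrib_right mult.assoc)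
    qed
    also have "\<dots> = (\<Sum>z'\<in>Z. c z' * (\<Sum>w\<in>?K. character I (z' + z) w))"
      by (simp add: sum_distrib_left sum.swap[of _ ?K])
    also have "\<dots> = (\<Sum>z'\<in>Z. if z' = z then c z * card ?K else 0)"
    proof (rule sum.cong[OF refl])
      fix z' assume z': "z' \<in> Z"
      show "c z' * (\<Sum>w\<in>?K. character I (z' + z) w) = (if z' = z then c z * card ?K else 0)"
      proof (cases "z' = z")
        case True
        then show ?thesis by (simp add: character_def)
      next
        case False
        have "\<not> eqv z' z"
        proof
          assume "eqv z' z"
          with nontriv1[OF z] have "z' \<in> Z1" using z' by (auto simp: Z1_def Z0_def eqv_def)
          then show False using no False \<open>eqv z' z\<close> by blast
        qed
        then obtain w where "w \<in> ?K" "ip I z' w \<noteq> ip I z w" unfolding eqv_def by blast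
        then have "(\<Sum>w\<in>?K. character I (z' + z) w) = 0"
          by (intro sum_character_kernel_eq_0[of w]) (simp_all flip: bit_not_zero_iff)
        then show ?thesis using False by simp
      qed
    qed
    also have "\<dots> = c z * card ?K" using z Z(1) by (simp add: Z1_def)
    finally show False using c_nz[of z] cpos z by (simp add: Z1_def)
  qed
  define \<rho> where "\<rho> z = (SOME z'. z' \<in> Z1 \<and> eqv z' z)" for z
  have \<rho>: "\<rho> z \<in> Z1" "eqv (\<rho> z) z" if "z \<in> Z1" for z
    using someI_ex[of "\<lambda>z'. z' \<in> Z1 \<and> eqv z' z"] that unfolding \<rho>_def by (auto simp: eqv_def)
  have \<rho>_cong: "\<rho> z = \<rho> z'" if "eqv z z'" for z z'
    using that unfolding \<rho>_def eqv_def by (intro arg_cong[where f = Eps]) (auto simp: fun_eq_iff)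
  have fin1: "finite Z1" using Z(1) by (simp add: Z1_def)
  have "2 * card (\<rho> ` Z1) = (\<Sum>y\<in>\<rho> ` Z1. 2)" by simp
  also have "\<dots> \<le> (\<Sum>y\<in>\<rho> ` Z1. card {z \<in> Z1. \<rho> z = y})"
  proof (rule sum_mono)
    fix y assume "y \<in> \<rho> ` Z1"
    then obtain z where z: "z \<in> Z1" "y = \<rho> z" by blast
    obtain z' where z': "z' \<in> Z1" "z' \<noteq> z" "eqv z' z" using twin[OF z(1)] by blast
    have "{z, z'} \<subseteq> {z \<in> Z1. \<rho> z = y}" using z z' \<rho>_cong by auto
    from card_mono[OF _ this] show "2 \<le> card {z \<in> Z1. \<rho> z = y}" using fin1 z' by simp
  qed
  also have "\<dots> = card Z1"
    using sum.image_gen[OF fin1, of "\<lambda>_. 1::nat" \<rho>] by simp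
  finally have card_\<rho>: "card (\<rho> ` Z1) \<le> (t - 1) div 2" using card_Z1 by linarith
  \<comment> \<open>Moving the base point to \<open>x + u\<close> only rescales coefficients by
    signs. The classes depend on \<open>?K\<close> alone, so the halving holds for all answers to
    \<open>B\<close>, although \<open>B\<close> certifies \<open>f\<close> only at
    \<open>x\<close>.\<close>
  have "of_bit (f (x + u + w)) = (c0 + (\<Sum>z\<in>Z0. c z * character I z u)) +
      (\<Sum>y\<in>\<rho> ` Z1. (\<Sum>z | z \<in> Z1 \<and> \<rho> z = y. c z * character I z u) * character I y w)"
    if w: "w \<in> ?K" for w
  proof -
    have "u + w \<in> ?L" using kernel_add[OF u] KL w by blast
    from F[OF this] have "of_bit (f (x + u + w))
        = c0 + (\<Sum>z\<in>Z. c z * character I z u * character I z w)"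
      by (simp add: character_add_right ac_simps)
    also have "(\<Sum>z\<in>Z. c z * character I z u * character I z w)
        = (\<Sum>z\<in>Z1. c z * character I z u * character I z w)
          + (\<Sum>z\<in>Z0. c z * character I z u * character I z w)"
      unfolding Z1_def using Z(1) by (intro sum.subset_diff) (auto simp: Z0_def)
    also have "(\<Sum>z\<in>Z0. c z * character I z u * character I z w) = (\<Sum>z\<in>Z0. c z * character I z u)"
      using w by (intro sum.cong) (auto simp: Z0_def character_def[of I _ w])
    also have "(\<Sum>z\<in>Z1. c z * character I z u * character I z w)
        = (\<Sum>z\<in>Z1. c z * character I z u * character I (\<rho> z) w)"
      using w \<rho>(2) by (intro sum.cong) (auto simp: eqv_def character_def[of I _ w])
    also have "\<dots> = (\<Sum>y\<in>\<rho> ` Z1. \<Sum>z | z \<in> Z1 \<and> \<rho> z = y.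
        c z * character I z u * character I (\<rho> z) w)"
      by (rule sum.image_gen[OF fin1])
    also have "\<dots> = (\<Sum>y\<in>\<rho> ` Z1. (\<Sum>z | z \<in> Z1 \<and> \<rho> z = y. c z * character I z u) * character I y w)"
      by (intro sum.cong) (auto simp: sum_distrib_right)
    finally show ?thesis by simp
  qed
  then have "sparse_on I f (Q \<union> B) (x + u) ((t - 1) div 2)"
    unfolding sparse_on_def using card_\<rho> finite_imageI[OF fin1]
    by (intro exI[of _ "\<rho> ` Z1"] exI[of _ "c0 + (\<Sum>z\<in>Z0. c z * character I z u)"]
        exI[of _ "\<lambda>y. \<Sum>z | z \<in> Z1 \<and> \<rho> z = y. c z * character I z u"]) blast
  with card_Z1 show ?thesis by simp
qed

text \<open>Each round costs at most \<open>m\<close> queries and sends \<open>t + 1\<close> to at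
  most its half, so \<open>r\<close> rounds suffice to exhaust the nonconstant characters.\<close>

lemma decidable_on_sparse:
  fixes f :: "('i \<Rightarrow> bit) \<Rightarrow> bit"
  assumes "finite I"
    and cert: "\<And>x. x \<in> cube I \<Longrightarrow> \<exists>A. certifies I f A x \<and> card A \<le> m"
    and "x \<in> cube I" "sparse_on I f Q x t" "t + 1 < 2 ^ Suc r"
  shows "decidable_on I f (coset I Q x) (r * m)"
  using assms(3-)
proof (induction r arbitrary: Q x t)
  case 0
  then obtain Z c0 c where Z: "finite Z" "card Z \<le> 0"
    and F: "\<And>w. w \<in> kernel I Q \<Longrightarrow>
      of_bit (f (x + w)) = c0 + (\<Sum>z\<in>Z. c z * character I z w)"
    unfolding sparse_on_def by auto
  \<comment> \<open>Here \<open>t + 1 < 2\<close> forces \<open>t = 0\<close>, so only the constant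
    term remains.\<close>
  then have F: "\<And>w. w \<in> kernel I Q \<Longrightarrow> of_bit (f (x + w)) = c0" by simp
  have "f y = f x" if "y \<in> coset I Q x" for y
  proof -
    have "x + y \<in> kernel I Q" using that coset_iff_kernel[OF 0(1)] by blast
    from F[OF this] F[OF zero_in_kernel] have "of_bit (f y) = (of_bit (f x) :: real)" by simp
    then show ?thesis by (cases "f y"; cases "f x") auto
  qed
  then show ?case by (rule decidable_on_const)
next
  case (Suc r)
  show ?case
  proof (cases "\<exists>w\<in>kernel I Q. f (x + w) \<noteq> f x")
    case False
    have "f y = f x" if "y \<in> coset I Q x" for y
      using False that coset_iff_kernel[OF Suc.prems(1)] by force
    then show ?thesis by (rule decidable_on_const)
  next
    case True
    obtain B where B: "certifies I f B x" "card B \<le> m" using cert Suc.prems(1) by blast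
    then have "finite B" by (simp add: certifies_def)
    then have "decidable_on I f (coset I Q x) (card B + r * m)"
    proof (rule decidable_on_query_all)
      fix x' assume x': "x' \<in> coset I Q x"
      then have "x + x' \<in> kernel I Q" using coset_iff_kernel[OF Suc.prems(1)] by blast
      from sparse_on_halve[OF assms(1) Suc.prems(2) B(1) True this]
      have "t > 0" "sparse_on I f (Q \<union> B) x' ((t - 1) div 2)" by simp_all
      moreover have "(t - 1) div 2 + 1 < 2 ^ Suc r" using Suc.prems(3) \<open>t > 0\<close> by simp
      ultimately have "decidable_on I f (coset I (Q \<union> B) x') (r * m)"
        using Suc.IH x' coset_subset_cube by blast
      then show "decidable_on I f {y \<in> coset I Q x. \<forall>a\<in>B. ip I a y = ip I a x'} (r * m)"
        by (simp add: coset_refine[OF x'])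
    qed
    then show ?thesis by (rule decidable_on_mono) (use B in simp)
  qed
qed

section \<open>Fourier inversion and the spectrum on the whole cube\<close>

lemma kernel_empty [simp]: "kernel I {} = cube I"
  by (simp add: kernel_def)

lemma coset_empty [simp]: "coset I {} x = cube I"
  by (simp add: coset_def)

lemma fourier_character:
  "fourier n f z = (\<Sum>x\<in>cube {..<n}. of_bit (f x) * character {..<n} x z) / 2 ^ n"
proof -
  have "(- 1) ^ (of_bit (ip {..<n} x z) :: nat) = character {..<n} x z" for x
    by (cases "ip {..<n} x z") (simp_all add: character_def)
  then show ?thesis by (simp add: fourier_def)
qed

text \<open>Orthogonality: for \<open>x \<noteq> w\<close>, a unit vector at a coordinate where they
  differ makes the character of \<open>x + w\<close> nontrivial on the cube, which is the kernel of
  the empty set.\<close>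

lemma fourier_inversion:
  assumes w: "w \<in> cube {..<n}"
  shows "of_bit (f w) = (\<Sum>z\<in>cube {..<n}. fourier n f z * character {..<n} z w)"
proof -
  let ?I = "{..<n}"
  have orth: "(\<Sum>z\<in>cube ?I. character ?I (x + w) z) = (if x = w then 2 ^ n else 0)"
    if x: "x \<in> cube ?I" for x
  proof (cases "x = w")
    case True
    then show ?thesis by (simp add: character_def card_cube)
  next
    case False
    then obtain j where j: "x j \<noteq> w j" by (auto simp: fun_eq_iff)
    then have "j \<in> ?I" using x w by (cases "j \<in> ?I") (auto simp: cube_def)
    then have "ip ?I (x + w) (unit_vec j) = 1"
      using j by (simp add: ip_unit_vec flip: bit_not_zero_iff)
    moreover have "unit_vec j \<in> kernel ?I {}"
      using \<open>j \<in> ?I\<close> by (simp add: cube_def unit_vec_def)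
    ultimately have "(\<Sum>z\<in>kernel ?I {}. character ?I (x + w) z) = 0"
      by (rule sum_character_kernel_eq_0[rotated])
    then show ?thesis using False by simp
  qed
  have "(\<Sum>z\<in>cube ?I. fourier n f z * character ?I z w)
      = (\<Sum>z\<in>cube ?I. \<Sum>x\<in>cube ?I. of_bit (f x) / 2 ^ n * character ?I (x + w) z)"
    unfolding fourier_character
    by (simp add: sum_divide_distrib sum_distrib_right character_add_left
        character_commute[of ?I w] mult.assoc)
  also have "\<dots> = (\<Sum>x\<in>cube ?I. of_bit (f x) / 2 ^ n * (\<Sum>z\<in>cube ?I. character ?I (x + w) z))"
    by (subst sum.swap) (simp add: sum_distrib_left)
  also have "\<dots> = (\<Sum>x\<in>cube ?I. if x = w then of_bit (f w) else 0)"
    using orth by (intro sum.cong) auto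
  also have "\<dots> = of_bit (f w)" using w by (simp add: finite_cube)
  finally show ?thesis by simp
qed

text \<open>The coefficient at 0 is the mean of a nonnegative function.\<close>

lemma fourier_0_eq_0_iff: "fourier n f 0 = 0 \<longleftrightarrow> (\<forall>x\<in>cube {..<n}. f x = 0)"
proof -
  have "fourier n f 0 = 0 \<longleftrightarrow> (\<Sum>x\<in>cube {..<n}. of_bit (f x) :: real) = 0"
    by (simp add: fourier_character character_def)
  also have "\<dots> \<longleftrightarrow> (\<forall>x\<in>cube {..<n}. f x = 0)"
    by (subst sum_nonneg_eq_0_iff) (auto simp: finite_cube)
  finally show ?thesis .
qed

text \<open>A nonzero \<open>f\<close> has 0 in its spectrum, and leaving out that constant
  character gives \<open>spar n f - 1\<close>.\<close>

lemma sparse_on_cube: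
  assumes "\<exists>x\<in>cube {..<n}. f x \<noteq> 0"
  shows "spar n f > 0 \<and> sparse_on {..<n} f {} 0 (spar n f - 1)"
proof -
  let ?S = "{z \<in> cube {..<n}. fourier n f z \<noteq> 0}"
  have S: "finite ?S" "0 \<in> ?S" using assms by (auto simp: finite_cube fourier_0_eq_0_iff)
  have "of_bit (f (0 + w)) = fourier n f 0 + (\<Sum>z\<in>?S - {0}. fourier n f z * character {..<n} z w)"
    if "w \<in> kernel {..<n} {}" for w
  proof -
    have "of_bit (f w) = (\<Sum>z\<in>?S. fourier n f z * character {..<n} z w)"
      using fourier_inversion[of w n f] that finite_cube[of "{..<n}"]
      by (simp, intro sum.mono_neutral_right) auto
    then show ?thesis using S by (simp add: sum.remove[of ?S 0] character_def[of _ 0])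
  qed
  moreover have "card (?S - {0}) \<le> spar n f - 1" using S by (simp add: spar_def)
  moreover have "finite (?S - {0})" using S by blast
  ultimately have "sparse_on {..<n} f {} 0 (spar n f - 1)"
    unfolding sparse_on_def by blast
  moreover have "spar n f > 0"
    unfolding spar_def using S by (metis card_gt_0_iff empty_iff)
  ultimately show ?thesis by blast
qed

section \<open>From decision procedures to the two lower bounds\<close>

lemma pdt_complexity_le_decidable:
  assumes "decidable_on I f (cube I) r"
  shows "pdt_complexity I f \<le> r"
proof -
  obtain T where "computes I T f" "depth T \<le> r"
    using assms unfolding decidable_on_def computes_def by blast
  then show ?thesis using pdt_complexity_le[of I T f] by simp
qed

theorem theorem4:
  fixes n k :: nat and f :: "(nat \<Rightarrow> bit) \<Rightarrow> bit"
  assumes "k \<ge> 1"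
  shows "real (pdt_complexity ({..<k} \<times> {..<n}) (direct_power k f))
           \<ge> real k * sqrt (real (pdt_complexity {..<n} f)) \<and>
         real (pdt_complexity ({..<k} \<times> {..<n}) (direct_power k f))
           \<ge> real k * real (pdt_complexity {..<n} f) / log 2 (real (spar n f))"
proof -
  let ?I = "{..<n}"
  define d where "d = pdt_complexity ({..<k} \<times> ?I) (direct_power k f)"
  define D where "D = pdt_complexity ?I f"
  \<comment> \<open>Certificate sizes are integers, so \<open>k * card A \<le> d\<close> yields the
    bound \<open>d div k\<close>.\<close>
  define m where "m = d div k"
  have cert: "\<exists>A. certifies ?I f A x \<and> card A \<le> m" if "x \<in> cube ?I" for x
  proof -
    obtain A where "certifies ?I f A x" "k * card A \<le> d"
      using certificate_of_direct_power[OF \<open>x \<in> cube ?I\<close>, of f k] unfolding d_def by blast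
    then show ?thesis
      using assms by (auto simp: m_def less_eq_div_iff_mult_less_eq mult.commute)
  qed
  have "k * m \<le> d" by (simp add: m_def)
  then have km: "real k * real m \<le> real d" by (metis of_nat_le_iff of_nat_mult)
  \<comment> \<open>Before any query the coset is the whole cube, and zeros of \<open>f\<close> have
    certificates of size at most \<open>c = m\<close>.\<close>
  have "decidable_on ?I f (coset ?I {} 0) (m * m)"
  proof (rule decidable_on_rounds[OF cert])
    fix y assume y: "y \<in> coset ?I {} 0" "f y = 0"
    then show "\<exists>A. finite A \<and> card A \<le> m \<and> (\<forall>z\<in>kernel ?I ({} \<union> A). f (y + z) = 0)"
      using cert[of y] by (auto simp: certifies_def)
  qed simp_all
  then have "D \<le> m * m" by (auto simp: D_def intro: pdt_complexity_le_decidable)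
  then have "real D \<le> (real m)\<^sup>2" by (metis of_nat_le_iff of_nat_mult power2_eq_square)
  then have "sqrt D \<le> m" by (simp add: real_le_lsqrt)
  then have "real k * sqrt D \<le> real k * m" by (rule mult_left_mono) simp
  moreover have "real k * D / log 2 (spar n f) \<le> d"
  proof (cases "\<exists>x\<in>cube ?I. f x \<noteq> 0")
    case False
    then have "decidable_on ?I f (cube ?I) 0" by (intro decidable_on_const[where c = 0]) auto
    then have "D = 0" using pdt_complexity_le_decidable unfolding D_def by blast
    then show ?thesis by simp
  next
    case True
    from sparse_on_cube[OF this]
    have sp: "spar n f > 0" "sparse_on ?I f {} 0 (spar n f - 1)" by auto
    \<comment> \<open>\<open>r\<close> is the floor of the logarithm; with
      \<open>t = spar n f - 1\<close>, its upper bound is exactly the condition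
      \<open>t + 1 < 2 ^ Suc r\<close>.\<close>
    obtain r where r: "2 ^ r \<le> spar n f" "spar n f < 2 ^ (r + 1)"
      using ex_power_ivl1[of 2 "spar n f"] sp(1) by auto
    have "decidable_on ?I f (coset ?I {} 0) (r * m)"
      using r(2) sp by (intro decidable_on_sparse[OF _ cert _ sp(2)]) simp_all
    then have "D \<le> r * m" by (auto simp: D_def intro: pdt_complexity_le_decidable)
    then have Drm: "real D \<le> real r * real m" by (metis of_nat_le_iff of_nat_mult)
    have "real (2 ^ r) \<le> real (spar n f)" using r(1) by (simp only: of_nat_le_iff)
    then have rl: "real r \<le> log 2 (spar n f)"
      using sp(1) by (simp add: le_log_iff powr_realpow)
    show ?thesis
    \<comment> \<open>If the logarithm vanishes, the quotient is 0 by the convention for division by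
      zero.\<close>
    proof (cases "log 2 (spar n f) = 0")
      case False
      then have pos: "log 2 (spar n f) > 0" using rl by linarith
      have "real k * D \<le> real k * (real r * m)" using Drm by (rule mult_left_mono) simp
      also have "\<dots> = real r * (real k * m)" by simp
      also have "\<dots> \<le> log 2 (spar n f) * d" using rl km pos by (intro mult_mono) auto
      finally show ?thesis using pos by (simp add: divide_le_eq mult.commute)
    qed simp
  qed
  ultimately show ?thesis using km unfolding d_def D_def by linarith
qed

end
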